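(* Let $p$ be a prime and let $m$ be a positive integer with $p\nmid m$. Let $G=D_m=G(m,m,2)$ be the dihedral group, over a field $K$ of characteristic $p$ containing all $m$-th roots of unity, let $\tau$ be the trivial representation, and let $c$ be generic. Then $x_1^px_2^p\in J_c$ and $x_1^{pm}+x_2^{pm}\in J_c$.
   Context: Let $\zeta\in K$ be a primitive $m$-th root of unity. The reflections of $D_m$ are $s_k$, $0\le k<m$, acting on $\mathfrak h^*=Kx_1\oplus Kx_2$ by the matrix $\begin{bmatrix}0&\zeta^{-k}\\ \zeta^{k}&0\end{bmatrix}$, i.e. $s_k(x_1)=\zeta^kx_2$, $s_k(x_2)=\zeta^{-k}x_1$; they generate $D_m$, and $\alpha_{s_k}=x_1-\zeta^kx_2$ spans the image of $1-s_k$. Parameters $c_{s}$ are attached to the reflections, constant on conjugacy classes (one class if $m$ is odd; two classes, $k$ even and $k$ odd, if $m$ is even); "generic" means that the $c_s$ are algebraically independent indeterminates, adjoined to the ground field. Let $y_1,y_2$ be the basis of $\mathfrak h$ dual to $x_1,x_2$. For a representation $\tau$ of $D_m$, the Verma module of the rational Cherednik algebra $H_{1,c}(D_m,\mathfrak h)$ is $M_c(\tau)=K[x_1,x_2]\otimes\tau$, graded by polynomial degree, where $x_i$ acts by multiplication, $D_m$ acts diagonally, and $y_i$ acts by the Dunkl operator $D_i(f\otimes v)=\frac{\partial f}{\partial x_i}\otimes v-\sum_{k=0}^{m-1}c_{s_k}(y_i,\alpha_{s_k})\frac{f-s_k(f)}{\alpha_{s_k}}\otimes s_k(v)$, where $(y_1,\alpha_{s_k})=1$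 and $(y_2,\alpha_{s_k})=-\zeta^k$. For irreducible $\tau$, $J_c$ is the unique maximal proper graded submodule of $M_c(\tau)$ (submodule: stable under multiplication by $x_1,x_2$, under $D_m$, and under $D_1,D_2$). For $\tau$ trivial, $M_c(\tau)=K[x_1,x_2]$. *)

theory Defs
  imports
    "HOL-Analysis.Cartesian_Space"
    "HOL-Computational_Algebra.Polynomial_Factorial"
    "HOL-Library.Poly_Mapping"
begin

text \<open>
  \<open>K[x\<^sub>1, x\<^sub>2]\<close> is the type \<open>'a poly poly\<close>: the variable of the inner polynomials is \<open>x\<^sub>1\<close>,
  that of the outer ones is \<open>x\<^sub>2\<close>, so \<open>coeff (coeff f j) i\<close> is the coefficient of
  \<open>x\<^sub>1\<^sup>i x\<^sub>2\<^sup>j\<close>. Linear forms are written in the basis \<open>x\<^sub>1, x\<^sub>2\<close> of \<open>\<hh>\<^sup>*\<close> as vectors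
  of type \<open>'a^2\<close>; pairing with the dual basis vector \<open>y\<^sub>i\<close> then is taking the \<open>i\<close>-th component.
\<close>

definition const :: "'a::field \<Rightarrow> 'a poly poly" where
  "const a = [:[:a:]:]"

definition x1 :: "'a::field poly poly" where
  "x1 = [:[:0, 1:]:]"

definition x2 :: "'a::field poly poly" where
  "x2 = [:0, 1:]"

definition linear_form :: "'a::field ^ 2 \<Rightarrow> 'a poly poly" where
  "linear_form v = const (v $ 1) * x1 + const (v $ 2) * x2"

definition partial :: "2 \<Rightarrow> 'a::field poly poly \<Rightarrow> 'a poly poly" where
  "partial i f = (if i = 1 then map_poly pderiv f else pderiv f)"

definition hom_component :: "nat \<Rightarrow> 'a::field poly poly \<Rightarrow> 'a poly poly" where
  "hom_component d f = (\<Sum>i\<le>d. const (coeff (coeff f (d - i)) i) * x1 ^ i * x2 ^ (d - i))"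

definition subst :: "'a::field poly poly \<Rightarrow> 'a poly poly \<Rightarrow> 'a poly poly \<Rightarrow> 'a poly poly" where
  "subst g h f = poly (map_poly (\<lambda>q. poly (map_poly const q) g) f) h"

text \<open>
  A matrix \<open>A\<close> acts on \<open>\<hh>\<^sup>*\<close> by sending \<open>x\<^sub>j\<close> to the linear form given by its \<open>j\<close>-th column,
  and on \<open>K[x\<^sub>1, x\<^sub>2]\<close> by the algebra automorphism extending this.
\<close>

definition act :: "'a::field ^ 2 ^ 2 \<Rightarrow> 'a poly poly \<Rightarrow> 'a poly poly" where
  "act A = subst (linear_form (column 1 A)) (linear_form (column 2 A))"

definition primitive_root_of_unity :: "nat \<Rightarrow> 'a::field \<Rightarrow> bool" where
  "primitive_root_of_unity m \<zeta> \<longleftrightarrow> 0 < m \<and> \<zeta> ^ m = 1 \<and> (\<forall>j. 0 < j \<and> j < m \<longrightarrow> \<zeta> ^ j \<noteq> 1)"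

definition refl_mat :: "'a::field \<Rightarrow> nat \<Rightarrow> 'a ^ 2 ^ 2" where
  "refl_mat \<zeta> k = vector [vector [0, inverse (\<zeta> ^ k)], vector [\<zeta> ^ k, 0]]"

definition refl_root :: "'a::field \<Rightarrow> nat \<Rightarrow> 'a ^ 2" where
  "refl_root \<zeta> k = vector [1, - (\<zeta> ^ k)]"

text \<open>
  The group generated by the reflections; these are involutions, so closure under products suffices.
\<close>

inductive_set dihedral :: "nat \<Rightarrow> 'a::field \<Rightarrow> ('a ^ 2 ^ 2) set" for m \<zeta> where
  one: "mat 1 \<in> dihedral m \<zeta>"
| refl: "g \<in> dihedral m \<zeta> \<Longrightarrow> k < m \<Longrightarrow> refl_mat \<zeta> k ** g \<in> dihedral m \<zeta>"

definition conj_class :: "nat \<Rightarrow> 'a::field \<Rightarrow> 'a ^ 2 ^ 2 \<Rightarrow> ('a ^ 2 ^ 2) set" where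
  "conj_class m \<zeta> s = {g ** s ** matrix_inv g | g. g \<in> dihedral m \<zeta>}"

definition refl_classes :: "nat \<Rightarrow> 'a::field \<Rightarrow> ('a ^ 2 ^ 2) set set" where
  "refl_classes m \<zeta> = (\<lambda>k. conj_class m \<zeta> (refl_mat \<zeta> k)) ` {..<m}"

text \<open>
  Dunkl operators on the Verma module \<open>K[x\<^sub>1, x\<^sub>2]\<close> of the trivial representation (so \<open>s\<^sub>k\<close> fixes
  \<open>\<tau>\<close>). The parameter of a reflection \<open>s\<close> is \<open>c s\<close>. The division by the root is exact.
\<close>

definition dunkl ::
  "nat \<Rightarrow> 'a::field \<Rightarrow> ('a ^ 2 ^ 2 \<Rightarrow> 'a) \<Rightarrow> 2 \<Rightarrow> 'a poly poly \<Rightarrow> 'a poly poly" where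
  "dunkl m \<zeta> c i f = partial i f -
     (\<Sum>k<m. const (c (refl_mat \<zeta> k) * refl_root \<zeta> k $ i) *
        ((f - act (refl_mat \<zeta> k) f) div linear_form (refl_root \<zeta> k)))"

definition cherednik_submodule ::
  "nat \<Rightarrow> 'a::field \<Rightarrow> ('a ^ 2 ^ 2 \<Rightarrow> 'a) \<Rightarrow> 'a poly poly set \<Rightarrow> bool" where
  "cherednik_submodule m \<zeta> c J \<longleftrightarrow>
     0 \<in> J \<and> (\<forall>f\<in>J. \<forall>g\<in>J. f + g \<in> J) \<and> (\<forall>a. \<forall>f\<in>J. const a * f \<in> J) \<and>
     (\<forall>f\<in>J. x1 * f \<in> J \<and> x2 * f \<in> J) \<and>
     (\<forall>g\<in>dihedral m \<zeta>. \<forall>f\<in>J. act g f \<in> J) \<and>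
     (\<forall>i. \<forall>f\<in>J. dunkl m \<zeta> c i f \<in> J)"

definition graded :: "'a::field poly poly set \<Rightarrow> bool" where
  "graded J \<longleftrightarrow> (\<forall>f\<in>J. \<forall>d. hom_component d f \<in> J)"

definition proper_graded_submodule ::
  "nat \<Rightarrow> 'a::field \<Rightarrow> ('a ^ 2 ^ 2 \<Rightarrow> 'a) \<Rightarrow> 'a poly poly set \<Rightarrow> bool" where
  "proper_graded_submodule m \<zeta> c J \<longleftrightarrow> cherednik_submodule m \<zeta> c J \<and> graded J \<and> J \<noteq> UNIV"

definition J_max :: "nat \<Rightarrow> 'a::field \<Rightarrow> ('a ^ 2 ^ 2 \<Rightarrow> 'a) \<Rightarrow> 'a poly poly set" where
  "J_max m \<zeta> c = (THE J. proper_graded_submodule m \<zeta> c J \<and>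
     (\<forall>J'. proper_graded_submodule m \<zeta> c J' \<and> J \<subseteq> J' \<longrightarrow> J' = J))"

text \<open>
  The ground field \<open>'k\<close> is embedded by \<open>\<iota>\<close> into the field \<open>'l\<close> obtained by adjoining the generic
  parameters. \<open>('i \<Rightarrow>\<^sub>0 nat) \<Rightarrow>\<^sub>0 'k\<close> is the type of polynomials over \<open>'k\<close> in variables indexed by
  \<open>'i\<close>.
\<close>

definition field_embedding :: "('k::field \<Rightarrow> 'l::field) \<Rightarrow> bool" where
  "field_embedding \<iota> \<longleftrightarrow> \<iota> 1 = 1 \<and> (\<forall>a b. \<iota> (a + b) = \<iota> a + \<iota> b) \<and> (\<forall>a b. \<iota> (a * b) = \<iota> a * \<iota> b)"

definition mpolys_in :: "'i set \<Rightarrow> (('i \<Rightarrow>\<^sub>0 nat) \<Rightarrow>\<^sub>0 'k::field) set" where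
  "mpolys_in I = {P. \<forall>t \<in> Poly_Mapping.keys P. Poly_Mapping.keys t \<subseteq> I}"

definition mpoly_eval ::
  "('k::field \<Rightarrow> 'l::field) \<Rightarrow> ('i \<Rightarrow> 'l) \<Rightarrow> (('i \<Rightarrow>\<^sub>0 nat) \<Rightarrow>\<^sub>0 'k) \<Rightarrow> 'l" where
  "mpoly_eval \<iota> v P = (\<Sum>t \<in> Poly_Mapping.keys P. \<iota> (Poly_Mapping.lookup P t) *
     (\<Prod>i \<in> Poly_Mapping.keys t. v i ^ Poly_Mapping.lookup t i))"

definition alg_independent ::
  "('k::field \<Rightarrow> 'l::field) \<Rightarrow> 'i set \<Rightarrow> ('i \<Rightarrow> 'l) \<Rightarrow> bool" where
  "alg_independent \<iota> I v \<longleftrightarrow> (\<forall>P \<in> mpolys_in I. mpoly_eval \<iota> v P = 0 \<longrightarrow> P = 0)"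

definition generated_as_field ::
  "('k::field \<Rightarrow> 'l::field) \<Rightarrow> 'i set \<Rightarrow> ('i \<Rightarrow> 'l) \<Rightarrow> bool" where
  "generated_as_field \<iota> I v \<longleftrightarrow> (\<forall>z. \<exists>P \<in> mpolys_in I. \<exists>Q \<in> mpolys_in I.
     mpoly_eval \<iota> v Q \<noteq> 0 \<and> z = mpoly_eval \<iota> v P / mpoly_eval \<iota> v Q)"

end

theory Submission
  imports Defs
begin

text \<open>
  Both polynomials are homogeneous of positive degree, invariant under the reflections, and
  polynomials in \<open>x\<^sub>1\<^sup>p, x\<^sub>2\<^sup>p\<close>. The last two properties make the Dunkl operators
  linear over multiplication by such an element \<open>f\<close>, so the principal ideal of \<open>f\<close> is a proper
  graded submodule. A graded submodule is proper iff it consists of polynomials without constant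
  term, whence the union of all of them is closed under addition and is \<open>J\<^sub>c\<close>.
\<close>

section \<open>Bivariate polynomials\<close>

lemma const_0 [simp]: "const 0 = 0"
  and const_1 [simp]: "const 1 = 1"
  and const_add: "const (a + b) = const a + const b"
  and const_minus: "const (- a) = - const a"
  and const_mult: "const (a * b) = const a * const b"
  by (simp_all add: const_def one_pCons)

lemma coeff_const_mult: "coeff (coeff (const a * f) j) i = a * coeff (coeff f j) i"
  by (simp add: const_def)

lemma coeff_x1_mult:
  "coeff (coeff (x1 * f) j) i = (case i of 0 \<Rightarrow> 0 | Suc i' \<Rightarrow> coeff (coeff f j) i')"
  by (simp add: x1_def coeff_pCons split: nat.split)

lemma coeff_x2_mult:
  "coeff (coeff (x2 * f) j) i = (case j of 0 \<Rightarrow> 0 | Suc j' \<Rightarrow> coeff (coeff f j') i)"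
  by (simp add: x2_def coeff_pCons split: nat.split)

lemma coeff_x1_power_mult:
  "coeff (coeff (x1 ^ n * f) j) i = (if n \<le> i then coeff (coeff f j) (i - n) else 0)"
  by (induction n arbitrary: i) (auto simp: mult.assoc coeff_x1_mult split: nat.split)

lemma coeff_x2_power:
  "coeff (coeff (x2 ^ n) j) i = (if j = n \<and> i = 0 then 1 else 0)"
proof (induction n arbitrary: j)
  case 0
  then show ?case by (simp add: coeff_1)
next
  case (Suc n)
  then show ?case by (auto simp: coeff_x2_mult split: nat.split)
qed

text \<open>The algebra is spanned by monomials, reached from 1 by scaling, adding and multiplying
  by the variables. A property of additive maps then needs checking only against these few
  operations. The proof nests an induction over powers of \<open>x1\<close> inside one over powers
  of \<open>x2\<close>.\<close>

lemma bipoly_induct [case_names zero one add const x1 x2]: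
  fixes f :: "'a::field poly poly"
  assumes zero: "P 0" and one: "P 1"
    and add: "\<And>f g. P f \<Longrightarrow> P g \<Longrightarrow> P (f + g)"
    and const: "\<And>a f. P f \<Longrightarrow> P (const a * f)"
    and x1: "\<And>f. P f \<Longrightarrow> P (x1 * f)"
    and x2: "\<And>f. P f \<Longrightarrow> P (x2 * f)"
  shows "P f"
proof (induction f)
  case 0
  show ?case by (rule zero)
next
  case (pCons q f)
  have "P [:q:]"
  proof (induction q)
    case 0
    show ?case using zero by simp
  next
    case (pCons a q)
    have "[:pCons a q:] = const a * 1 + x1 * [:q:]"
      by (simp add: const_def x1_def)
    then show ?case
      using add const one x1 pCons.IH by metis
  qed
  moreover have "pCons q f = [:q:] + x2 * f"
    by (simp add: x2_def)
  ultimately show ?case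
    using add x2 pCons.IH by metis
qed

section \<open>Substitution as an algebra homomorphism\<close>

lemma map_poly_add:
  assumes "F 0 = 0" and "\<And>a b. F (a + b) = F a + F b"
  shows "map_poly F (p + q) = map_poly F p + map_poly F q"
  by (rule poly_eqI) (simp add: coeff_map_poly assms)

lemma subst_0 [simp]: "subst g h 0 = 0"
  by (simp add: subst_def)

lemma subst_1 [simp]: "subst g h 1 = 1"
  by (simp add: subst_def map_poly_1)

lemma poly_map_const_add:
  "poly (map_poly const (p + q)) g = poly (map_poly const p) g + poly (map_poly const q) g"
  by (simp add: map_poly_add const_add)

lemma subst_add: "subst g h (p + q) = subst g h p + subst g h q"
  by (simp add: subst_def map_poly_add poly_map_const_add)

text \<open>Multiplicativity is asked for the one factor \<open>a\<close> only: evaluation of the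
  inner polynomials is not yet known to be multiplicative, but its behaviour on constants and on
  \<open>x1\<close> is.\<close>

lemma map_poly_smult_hom:
  assumes "F 0 = 0" and "\<And>b. F (a * b) = F a * F b"
  shows "map_poly F (smult a p) = smult (F a) (map_poly F p)"
  by (rule poly_eqI) (simp add: coeff_map_poly assms)

lemma subst_const_mult: "subst g h (const a * p) = const a * subst g h p"
proof -
  have "poly (map_poly const (smult a q)) g = const a * poly (map_poly const q) g" for q
    by (simp add: map_poly_smult_hom const_mult)
  moreover have "const a * p = smult [:a:] p"
    by (simp add: const_def)
  ultimately show ?thesis
    by (simp add: subst_def map_poly_smult_hom map_poly_pCons)
qed

lemma subst_x1_mult: "subst g h (x1 * p) = g * subst g h p"
proof -
  have "poly (map_poly const (pCons 0 q)) g = g * poly (map_poly const q) g" for q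
    by (simp add: map_poly_pCons)
  then show ?thesis
    by (simp add: subst_def x1_def map_poly_smult_hom map_poly_pCons)
qed

lemma subst_x2_mult: "subst g h (x2 * p) = h * subst g h p"
  by (simp add: subst_def x2_def map_poly_pCons)

lemma subst_mult: "subst g h (p * q) = subst g h p * subst g h q"
  by (induction p rule: bipoly_induct)
    (simp_all add: distrib_right subst_add subst_const_mult subst_x1_mult subst_x2_mult mult.assoc)

section \<open>The action of matrices\<close>

lemma act_0 [simp]: "act A 0 = 0"
  and act_1 [simp]: "act A 1 = 1"
  and act_add: "act A (f + g) = act A f + act A g"
  and act_mult: "act A (f * g) = act A f * act A g"
  by (simp_all add: act_def subst_add subst_mult)

lemma act_const [simp]: "act A (const a) = const a"
  using subst_const_mult[of _ _ a 1] by (simp add: act_def)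

lemma act_power: "act A (f ^ n) = act A f ^ n"
  by (induction n) (simp_all add: act_mult)

lemma act_x1: "act A x1 = const (A $ 1 $ 1) * x1 + const (A $ 2 $ 1) * x2"
  using subst_x1_mult[of _ _ 1] by (simp add: act_def linear_form_def column_def)

lemma act_x2: "act A x2 = const (A $ 1 $ 2) * x1 + const (A $ 2 $ 2) * x2"
  using subst_x2_mult[of _ _ 1] by (simp add: act_def linear_form_def column_def)

text \<open>Columns hold the images of the variables, so the order of composition is that of the
  matrix product. Both sides are algebra homomorphisms, hence agree once they agree on
  \<open>x1\<close> and \<open>x2\<close>.\<close>

lemma act_matrix_mult: "act (A ** B) f = act A (act B f)"
proof (induction f rule: bipoly_induct)
  case (x1 f)
  then show ?case
    by (simp add: act_mult act_x1 act_x2 act_add matrix_matrix_mult_def sum_2 const_add const_mult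
        algebra_simps)
next
  case (x2 f)
  then show ?case
    by (simp add: act_mult act_x1 act_x2 act_add matrix_matrix_mult_def sum_2 const_add const_mult
        algebra_simps)
qed (simp_all add: act_add act_mult)

lemma act_mat_1: "act (mat 1) f = f"
  by (induction f rule: bipoly_induct)
    (simp_all add: act_add act_mult act_x1 act_x2 mat_def)

lemma act_refl_x1: "act (refl_mat \<zeta> k) x1 = const (\<zeta> ^ k) * x2"
  and act_refl_x2: "act (refl_mat \<zeta> k) x2 = const (inverse (\<zeta> ^ k)) * x1"
  by (simp_all add: act_x1 act_x2 refl_mat_def)

lemma linear_form_refl_root: "linear_form (refl_root \<zeta> k) = x1 - const (\<zeta> ^ k) * x2"
  by (simp add: linear_form_def refl_root_def const_minus)

text \<open>The twisted Leibniz rule f g - s(f g) = g (f - s f) + s(f) (g - s g) reduces the claim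
  to the variables, where x1 - s(x1) = \<alpha> and x2 - s(x2) = -\<zeta>^(-k) \<alpha>. Exactness
  of the division is what makes \<open>div\<close> compatible with sums and products in the Dunkl
  operators.\<close>

lemma refl_root_dvd:
  fixes \<zeta> :: "'a::field"
  assumes "\<zeta> \<noteq> 0"
  shows "linear_form (refl_root \<zeta> k) dvd f - act (refl_mat \<zeta> k) f" (is "?\<alpha> dvd f - ?s f")
proof (induction f rule: bipoly_induct)
  case (add f g)
  have "f + g - ?s (f + g) = (f - ?s f) + (g - ?s g)"
    by (simp add: act_add)
  then show ?case using add by (metis dvd_add)
next
  case (const a f)
  have "const a * f - ?s (const a * f) = const a * (f - ?s f)"
    by (simp add: act_mult algebra_simps)
  then show ?case using const by (metis dvd_mult)
next
  case (x1 f)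
  have "x1 * f - ?s (x1 * f) = f * ?\<alpha> + (const (\<zeta> ^ k) * x2) * (f - ?s f)"
    by (simp add: act_mult act_refl_x1 linear_form_refl_root algebra_simps)
  then show ?case using x1 by (metis dvd_add dvd_mult dvd_triv_right)
next
  case (x2 f)
  have "const (inverse (\<zeta> ^ k)) * const (\<zeta> ^ k) = 1"
    using assms by (simp flip: const_mult)
  then have "const (inverse (\<zeta> ^ k)) * ?\<alpha> = const (inverse (\<zeta> ^ k)) * x1 - x2"
    by (simp add: linear_form_refl_root right_diff_distrib flip: mult.assoc)
  then have "x2 * f - ?s (x2 * f)
      = (- f * const (inverse (\<zeta> ^ k))) * ?\<alpha> + (const (inverse (\<zeta> ^ k)) * x1) * (f - ?s f)"
    by (simp add: act_mult act_refl_x2 mult.assoc right_diff_distrib)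
  then show ?case using x2 by (metis dvd_add dvd_mult dvd_triv_right)
qed simp_all

section \<open>Dunkl operators\<close>

lemma partial_add: "partial i (f + g) = partial i f + partial i g"
  by (simp add: partial_def map_poly_add pderiv_add)

lemma map_poly_pderiv_mult:
  fixes f g :: "'a::field poly poly"
  shows "map_poly pderiv (f * g) = map_poly pderiv f * g + f * map_poly pderiv g"
proof (rule poly_eqI)
  fix n
  \<comment> \<open>The derivative in \<open>x1\<close> acts on each coefficient of the outer
    polynomial, so the product rule is applied termwise in the convolution.
    \<open>higher_pderiv_sum\<close> at order 1 is additivity over finite sums.\<close>
  have "pderiv (\<Sum>i\<le>n. coeff f i * coeff g (n - i))
      = (\<Sum>i\<le>n. pderiv (coeff f i) * coeff g (n - i) + coeff f i * pderiv (coeff g (n - i)))"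
    by (simp add: higher_pderiv_sum[where n = 1, simplified] pderiv_mult mult.commute add.commute)
  then show "coeff (map_poly pderiv (f * g)) n = coeff (map_poly pderiv f * g + f * map_poly pderiv g) n"
    by (simp add: coeff_map_poly coeff_mult sum.distrib)
qed

lemma partial_mult: "partial i (f * g) = partial i f * g + f * partial i g"
  by (simp add: partial_def map_poly_pderiv_mult pderiv_mult)

lemma partial_1 [simp]: "partial i 1 = 0"
  by (simp add: partial_def map_poly_1)

lemma partial_power: "partial i (f ^ n) = of_nat n * f ^ (n - 1) * partial i f"
proof (induction n)
  case (Suc n)
  then show ?case
    by (cases n) (simp_all add: partial_mult algebra_simps)
qed simp

lemma dunkl_add:
  assumes "\<zeta> \<noteq> 0"
  shows "dunkl m \<zeta> c i (f + g) = dunkl m \<zeta> c i f + dunkl m \<zeta> c i g"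
proof -
  have "(f + g - act (refl_mat \<zeta> k) (f + g)) div linear_form (refl_root \<zeta> k)
      = (f - act (refl_mat \<zeta> k) f) div linear_form (refl_root \<zeta> k)
        + (g - act (refl_mat \<zeta> k) g) div linear_form (refl_root \<zeta> k)" for k
    using div_add[OF refl_root_dvd[OF assms, of k f] refl_root_dvd[OF assms, of k g]]
    by (simp add: act_add algebra_simps)
  then show ?thesis
    by (simp add: dunkl_def partial_add distrib_left sum.distrib)
qed

text \<open>An invariant f factors out of every difference f h - s(f h), and the Leibniz term
  containing the derivative of f vanishes.\<close>

lemma dunkl_mult_invariant:
  assumes "\<zeta> \<noteq> 0"
    and inv: "\<And>k. k < m \<Longrightarrow> act (refl_mat \<zeta> k) f = f"
    and "partial i f = 0"
  shows "dunkl m \<zeta> c i (f * h) = f * dunkl m \<zeta> c i h"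
proof -
  have "(f * h - act (refl_mat \<zeta> k) (f * h)) div linear_form (refl_root \<zeta> k)
      = f * ((h - act (refl_mat \<zeta> k) h) div linear_form (refl_root \<zeta> k))" if "k < m" for k
    using div_mult_swap[OF refl_root_dvd[OF assms(1), of k h], of f] inv[OF that]
    by (simp add: act_mult right_diff_distrib)
  then show ?thesis
    by (simp add: dunkl_def partial_mult assms(3) right_diff_distrib sum_distrib_left
        mult.left_commute)
qed

section \<open>The grading\<close>

lemma coeff_hom_component:
  "coeff (coeff (hom_component d f) j) i = (if i + j = d then coeff (coeff f j) i else 0)"
proof -
  have "coeff (coeff (hom_component d f) j) i =
      (\<Sum>k\<le>d. if k = i \<and> d - k = j then coeff (coeff f j) i else 0)"
    unfolding hom_component_def coeff_sum mult.assoc coeff_const_mult coeff_x1_power_mult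
      coeff_x2_power
    by (intro sum.cong) auto
  \<comment> \<open>Only the summand k = i survives, and it occurs only for i \<le> d, so the
    truncated d - i = j really says i + j = d.\<close>
  also have "\<dots> = (\<Sum>k\<le>d. if k = i then (if d - i = j then coeff (coeff f j) i else 0) else 0)"
    by (intro sum.cong) auto
  also have "\<dots> = (if i + j = d then coeff (coeff f j) i else 0)"
    by auto
  finally show ?thesis .
qed

lemma bipoly_eqI: "(\<And>i j. coeff (coeff f j) i = coeff (coeff g j) i) \<Longrightarrow> f = g"
  by (metis poly_eqI)

lemma hom_component_0 [simp]: "hom_component d 0 = 0"
  and hom_component_add: "hom_component d (f + g) = hom_component d f + hom_component d g"
  and hom_component_const_mult: "hom_component d (const a * f) = const a * hom_component d f"
  and hom_component_x1_mult:
    "hom_component d (x1 * f) = (case d of 0 \<Rightarrow> 0 | Suc d' \<Rightarrow> x1 * hom_component d' f)"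
  and hom_component_x2_mult:
    "hom_component d (x2 * f) = (case d of 0 \<Rightarrow> 0 | Suc d' \<Rightarrow> x2 * hom_component d' f)"
  by (auto intro!: bipoly_eqI simp: coeff_hom_component coeff_const_mult coeff_x1_mult coeff_x2_mult
      split: nat.split)

lemma hom_component_degree_0: "hom_component 0 f = const (coeff (coeff f 0) 0)"
  by (simp add: hom_component_def)

text \<open>Phrased through components, so that 0 is homogeneous of every degree and sums need no
  exceptional case.\<close>

definition homogeneous :: "nat \<Rightarrow> 'a::field poly poly \<Rightarrow> bool" where
  "homogeneous e f \<longleftrightarrow> (\<forall>d. hom_component d f = (if d = e then f else 0))"

lemma homogeneous_1: "homogeneous 0 1"
  unfolding homogeneous_def
  by (auto intro!: bipoly_eqI simp: coeff_hom_component coeff_1)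

lemma homogeneous_add: "homogeneous e f \<Longrightarrow> homogeneous e g \<Longrightarrow> homogeneous e (f + g)"
  by (simp add: homogeneous_def hom_component_add)

lemma homogeneous_x1_power_mult: "homogeneous e f \<Longrightarrow> homogeneous (n + e) (x1 ^ n * f)"
  by (induction n)
    (auto simp: homogeneous_def hom_component_x1_mult mult.assoc split: nat.split)

lemma homogeneous_x2_power_mult: "homogeneous e f \<Longrightarrow> homogeneous (n + e) (x2 ^ n * f)"
  by (induction n)
    (auto simp: homogeneous_def hom_component_x2_mult mult.assoc split: nat.split)

text \<open>This makes the principal ideal of a homogeneous element graded. Claiming divisibility
  instead of an explicit quotient lets the induction run without subtracting degrees.\<close>

lemma dvd_hom_component_mult:
  assumes "homogeneous e f"
  shows "f dvd hom_component d (f * h)"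
proof (induction h arbitrary: d rule: bipoly_induct)
  case one
  then show ?case using assms by (simp add: homogeneous_def)
next
  case (add g h)
  then show ?case by (simp add: distrib_left hom_component_add)
next
  case (const a h)
  then show ?case by (simp add: mult.left_commute[of f] hom_component_const_mult)
next
  case (x1 h)
  then show ?case by (simp add: mult.left_commute[of f] hom_component_x1_mult split: nat.split)
next
  case (x2 h)
  then show ?case by (simp add: mult.left_commute[of f] hom_component_x2_mult split: nat.split)
qed simp

section \<open>Graded submodules\<close>

lemma cherednik_submodule_mult:
  assumes "cherednik_submodule m \<zeta> c J" and "f \<in> J"
  shows "h * f \<in> J"
  using assms
  by (induction h rule: bipoly_induct)
    (auto simp: cherednik_submodule_def distrib_right mult.assoc)

text \<open>The degree 0 component of an element is its constant term; if nonzero, it is a unit of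
  the polynomial ring, and a submodule, being an ideal, is then everything. Properness thus becomes
  a condition on single elements, which passes to sums and unions.\<close>

lemma proper_graded_submodule_iff:
  fixes J :: "'a::field poly poly set"
  shows "proper_graded_submodule m \<zeta> c J \<longleftrightarrow>
    cherednik_submodule m \<zeta> c J \<and> graded J \<and> (\<forall>f\<in>J. coeff (coeff f 0) 0 = 0)"
proof -
  have "coeff (coeff f 0) 0 = 0"
    if J: "cherednik_submodule m \<zeta> c J" "graded J" "J \<noteq> UNIV" and f: "f \<in> J" for f
  proof (rule ccontr)
    let ?a = "coeff (coeff f 0) 0"
    assume nz: "?a \<noteq> 0"
    have "hom_component 0 f \<in> J"
      using J(2) f by (simp add: graded_def)
    then have "const ?a \<in> J"
      by (simp only: hom_component_degree_0)
    then have "h * const (inverse ?a) * const ?a \<in> J" for h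
      by (rule cherednik_submodule_mult[OF J(1)])
    moreover have "h * const (inverse ?a) * const ?a = h" for h
      using nz by (simp add: mult.assoc flip: const_mult)
    ultimately show False
      using J(3) by auto
  qed
  moreover have "J \<noteq> UNIV" if "\<forall>f\<in>J. coeff (coeff f 0) 0 = 0"
  proof
    assume "J = UNIV"
    then have "coeff (coeff (1 :: 'a poly poly) 0) 0 = 0"
      using that by blast
    then show False by simp
  qed
  ultimately show ?thesis
    unfolding proper_graded_submodule_def by blast
qed

text \<open>Elements of two different proper graded submodules have their sum in J + J'. This is why
  the union of all of them is closed under addition.\<close>

lemma proper_graded_submodule_sum:
  assumes "\<zeta> \<noteq> 0"
    and "proper_graded_submodule m \<zeta> c J" and "proper_graded_submodule m \<zeta> c J'"
  shows "proper_graded_submodule m \<zeta> c {f + g | f g. f \<in> J \<and> g \<in> J'}"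
    (is "proper_graded_submodule _ _ _ ?S")
proof -
  have J: "cherednik_submodule m \<zeta> c J" "graded J" "\<forall>f\<in>J. coeff (coeff f 0) 0 = 0"
    and J': "cherednik_submodule m \<zeta> c J'" "graded J'" "\<forall>f\<in>J'. coeff (coeff f 0) 0 = 0"
    using assms(2,3) unfolding proper_graded_submodule_iff by blast+
  \<comment> \<open>Every operation of the module structure and every projection to a component is
    additive, so this one principle handles them all.\<close>
  have S: "\<forall>u\<in>?S. T u \<in> ?S"
    if "\<And>f g. T (f + g) = T f + T g" "\<forall>f\<in>J. T f \<in> J" "\<forall>g\<in>J'. T g \<in> J'" for T
    using that by blast
  have "cherednik_submodule m \<zeta> c ?S"
    unfolding cherednik_submodule_def
  proof (intro conjI allI)
    have "0 + 0 \<in> ?S"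
      using J(1) J'(1) unfolding cherednik_submodule_def by blast
    then show "0 \<in> ?S" by simp
    have "(f + g) + (f' + g') \<in> ?S" if "f \<in> J" "g \<in> J'" "f' \<in> J" "g' \<in> J'" for f g f' g'
    proof -
      have "f + f' \<in> J" "g + g' \<in> J'"
        using J(1) J'(1) that by (simp_all add: cherednik_submodule_def)
      moreover have "(f + g) + (f' + g') = (f + f') + (g + g')"
        by simp
      ultimately show ?thesis by blast
    qed
    then show "\<forall>u\<in>?S. \<forall>v\<in>?S. u + v \<in> ?S" by blast
    show "\<forall>u\<in>?S. const a * u \<in> ?S" for a
      by (rule S) (use J(1) J'(1) in \<open>simp_all add: cherednik_submodule_def distrib_left\<close>)
    have "\<forall>u\<in>?S. x1 * u \<in> ?S"
      by (rule S) (use J(1) J'(1) in \<open>simp_all add: cherednik_submodule_def distrib_left\<close>)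
    moreover have "\<forall>u\<in>?S. x2 * u \<in> ?S"
      by (rule S) (use J(1) J'(1) in \<open>simp_all add: cherednik_submodule_def distrib_left\<close>)
    ultimately show "\<forall>u\<in>?S. x1 * u \<in> ?S \<and> x2 * u \<in> ?S" by blast
    have "\<forall>u\<in>?S. act A u \<in> ?S" if "A \<in> dihedral m \<zeta>" for A
      by (rule S) (use J(1) J'(1) that in \<open>simp_all add: cherednik_submodule_def act_add\<close>)
    then show "\<forall>A\<in>dihedral m \<zeta>. \<forall>u\<in>?S. act A u \<in> ?S" by blast
    show "\<forall>u\<in>?S. dunkl m \<zeta> c i u \<in> ?S" for i
      by (rule S)
        (use J(1) J'(1) in \<open>simp_all add: cherednik_submodule_def dunkl_add[OF assms(1)]\<close>)
  qed
  moreover have "graded ?S"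
  proof -
    have "\<forall>u\<in>?S. hom_component d u \<in> ?S" for d
      by (rule S) (use J(2) J'(2) in \<open>simp_all add: graded_def hom_component_add\<close>)
    then show ?thesis unfolding graded_def by blast
  qed
  moreover have "\<forall>u\<in>?S. coeff (coeff u 0) 0 = 0"
    using J(3) J'(3) by auto
  ultimately show ?thesis
    unfolding proper_graded_submodule_iff by blast
qed

section \<open>The largest proper graded submodule\<close>

lemma proper_graded_submodule_zero:
  assumes "\<zeta> \<noteq> 0"
  shows "proper_graded_submodule m \<zeta> c {0}"
proof -
  have "dunkl m \<zeta> c i 0 = 0" for i
    using dunkl_add[OF assms, of m c i 0 0] by (metis add.right_neutral add_left_cancel)
  then show ?thesis
    by (simp add: proper_graded_submodule_iff cherednik_submodule_def graded_def)
qed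

text \<open>The union is itself a proper graded submodule, hence the greatest one. So a maximal one
  exists and is unique, which is what the definite description in \<open>J_max\<close>
  requires.\<close>

lemma J_max_eq:
  assumes "\<zeta> \<noteq> 0"
  shows "J_max m \<zeta> c = \<Union> {J. proper_graded_submodule m \<zeta> c J}" (is "_ = ?U")
proof -
  have mem: "cherednik_submodule m \<zeta> c J" "graded J" "\<forall>f\<in>J. coeff (coeff f 0) 0 = 0"
    if "proper_graded_submodule m \<zeta> c J" for J
    using that unfolding proper_graded_submodule_iff by blast+
  \<comment> \<open>Unary operations stay inside the submodule an element comes from; only addition
    can mix two of them.\<close>
  have closed: "\<forall>u\<in>?U. T u \<in> ?U"
    if "\<And>J. proper_graded_submodule m \<zeta> c J \<Longrightarrow> \<forall>u\<in>J. T u \<in> J" for T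
    using that by blast
  have "cherednik_submodule m \<zeta> c ?U"
    unfolding cherednik_submodule_def
  proof (intro conjI allI)
    show "0 \<in> ?U"
      using proper_graded_submodule_zero[OF assms] by blast
    show "\<forall>u\<in>?U. \<forall>v\<in>?U. u + v \<in> ?U"
      using proper_graded_submodule_sum[OF assms] by blast
    show "\<forall>u\<in>?U. const a * u \<in> ?U" for a
      by (rule closed) (use mem(1) in \<open>simp add: cherednik_submodule_def\<close>)
    have "\<forall>u\<in>?U. x1 * u \<in> ?U"
      by (rule closed) (use mem(1) in \<open>simp add: cherednik_submodule_def\<close>)
    moreover have "\<forall>u\<in>?U. x2 * u \<in> ?U"
      by (rule closed) (use mem(1) in \<open>simp add: cherednik_submodule_def\<close>)
    ultimately show "\<forall>u\<in>?U. x1 * u \<in> ?U \<and> x2 * u \<in> ?U" by blast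
    have "\<forall>u\<in>?U. act A u \<in> ?U" if "A \<in> dihedral m \<zeta>" for A
      by (rule closed) (use mem(1) that in \<open>simp add: cherednik_submodule_def\<close>)
    then show "\<forall>A\<in>dihedral m \<zeta>. \<forall>u\<in>?U. act A u \<in> ?U" by blast
    show "\<forall>u\<in>?U. dunkl m \<zeta> c i u \<in> ?U" for i
      by (rule closed) (use mem(1) in \<open>simp add: cherednik_submodule_def\<close>)
  qed
  moreover have "graded ?U"
  proof -
    have "\<forall>u\<in>?U. hom_component d u \<in> ?U" for d
      by (rule closed) (use mem(2) in \<open>simp add: graded_def\<close>)
    then show ?thesis unfolding graded_def by blast
  qed
  moreover have "\<forall>u\<in>?U. coeff (coeff u 0) 0 = 0"
    using mem(3) by blast
  ultimately have U: "proper_graded_submodule m \<zeta> c ?U"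
    unfolding proper_graded_submodule_iff by blast
  show ?thesis
    unfolding J_max_def
  proof (rule the_equality)
    show "proper_graded_submodule m \<zeta> c ?U \<and>
        (\<forall>J'. proper_graded_submodule m \<zeta> c J' \<and> ?U \<subseteq> J' \<longrightarrow> J' = ?U)"
      using U by blast
    \<comment> \<open>Any candidate \<open>J\<close> lies in \<open>?U\<close>, so its maximality,
      applied to \<open>?U\<close>, forces equality.\<close>
    show "J = ?U" if "proper_graded_submodule m \<zeta> c J \<and>
        (\<forall>J'. proper_graded_submodule m \<zeta> c J' \<and> J \<subseteq> J' \<longrightarrow> J' = J)" for J
      using that U by blast
  qed
qed

section \<open>Principal ideals of invariants with vanishing derivatives\<close>

lemma invariant_in_J_max:
  assumes "\<zeta> \<noteq> 0"
    and "homogeneous e f" and "0 < e"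
    and inv: "\<And>k. k < m \<Longrightarrow> act (refl_mat \<zeta> k) f = f"
    and "\<And>i. partial i f = 0"
  shows "f \<in> J_max m \<zeta> c"
proof -
  let ?J = "{h. f dvd h}"
  \<comment> \<open>Invariance spreads from the reflections to the group they generate by rule
    induction.\<close>
  have act_f: "act A f = f" if "A \<in> dihedral m \<zeta>" for A
    using that by induction (simp_all add: act_mat_1 act_matrix_mult inv)
  have act: "f dvd act A h" if "A \<in> dihedral m \<zeta>" "f dvd h" for A h
  proof -
    obtain g where "h = f * g" using \<open>f dvd h\<close> ..
    then have "act A h = f * act A g" by (simp only: act_mult act_f[OF that(1)])
    then show ?thesis by simp
  qed
  have dunkl: "f dvd dunkl m \<zeta> c i h" if "f dvd h" for i h
  proof -
    obtain g where "h = f * g" using \<open>f dvd h\<close> ..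
    then have "dunkl m \<zeta> c i h = f * dunkl m \<zeta> c i g"
      using dunkl_mult_invariant[OF assms(1) inv assms(5)] by blast
    then show ?thesis by simp
  qed
  have "cherednik_submodule m \<zeta> c ?J"
    unfolding cherednik_submodule_def mem_Collect_eq Ball_def
    using act dunkl by (intro conjI allI impI dvd_add dvd_mult dvd_0_right) blast+
  moreover have "graded ?J"
    unfolding graded_def mem_Collect_eq Ball_def
  proof (intro allI impI)
    show "f dvd hom_component d h" if "f dvd h" for h d
    proof -
      obtain g where "h = f * g" using \<open>f dvd h\<close> ..
      then show ?thesis using dvd_hom_component_mult[OF assms(2)] by simp
    qed
  qed
  moreover have "\<forall>h\<in>?J. coeff (coeff h 0) 0 = 0"
  proof -
    \<comment> \<open>Being its own component of degree e > 0, f has no constant term, and neither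
      has any multiple of it.\<close>
    have "coeff (coeff f 0) 0 = coeff (coeff (hom_component e f) 0) 0"
      using assms(2) by (simp add: homogeneous_def)
    also have "\<dots> = 0"
      using assms(3) by (simp add: coeff_hom_component)
    finally have "coeff (coeff (f * g) 0) 0 = 0" for g
      by (simp add: coeff_mult_0)
    then show ?thesis unfolding dvd_def by blast
  qed
  ultimately have "proper_graded_submodule m \<zeta> c ?J"
    unfolding proper_graded_submodule_iff by blast
  moreover have "f \<in> ?J" by simp
  ultimately show ?thesis
    unfolding J_max_eq[OF assms(1)] by blast
qed

section \<open>The two invariants in characteristic p\<close>

theorem theorem4p1:
  fixes \<iota> :: "'k::field \<Rightarrow> 'l::field"
    and \<zeta> :: 'k
    and \<kappa> :: "('l ^ 2 ^ 2) set \<Rightarrow> 'l"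
    and c :: "'l ^ 2 ^ 2 \<Rightarrow> 'l"
    and p m :: nat
  assumes "prime p" and "0 < m" and "\<not> p dvd m"
    and "CHAR('k) = p"
    and "primitive_root_of_unity m \<zeta>"
    and "field_embedding \<iota>"
    and "alg_independent \<iota> (refl_classes m (\<iota> \<zeta>)) \<kappa>"
    and "generated_as_field \<iota> (refl_classes m (\<iota> \<zeta>)) \<kappa>"
    and "\<And>k. k < m \<Longrightarrow> c (refl_mat (\<iota> \<zeta>) k) = \<kappa> (conj_class m (\<iota> \<zeta>) (refl_mat (\<iota> \<zeta>) k))"
  shows "x1 ^ p * x2 ^ p \<in> J_max m (\<iota> \<zeta>) c \<and>
         x1 ^ (p * m) + x2 ^ (p * m) \<in> J_max m (\<iota> \<zeta>) c"
proof -
  let ?z = "\<iota> \<zeta>"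
  have \<iota>: "\<iota> 1 = 1" "\<And>a b. \<iota> (a + b) = \<iota> a + \<iota> b" "\<And>a b. \<iota> (a * b) = \<iota> a * \<iota> b"
    using assms(6) by (auto simp: field_embedding_def)
  have \<iota>0: "\<iota> 0 = 0"
    using \<iota>(2)[of 0 0] by (metis add.right_neutral add_left_cancel)
  have \<iota>_nat: "\<iota> (of_nat n) = of_nat n" for n
    by (induction n) (simp_all add: \<iota> \<iota>0)
  have \<iota>_power: "\<iota> (\<zeta> ^ n) = ?z ^ n" for n
    by (induction n) (simp_all add: \<iota>)
  \<comment> \<open>The characteristic is carried along \<open>\<iota>\<close> to the larger field
    and from there to the polynomial ring.\<close>
  have "of_nat p = (0 :: 'l)"
    using \<iota>_nat[of p] assms(4) \<iota>0 by (metis of_nat_CHAR)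
  then have p0: "of_nat p = (0 :: 'l poly poly)"
    by (simp add: of_nat_poly)
  have zm: "?z ^ m = 1"
    using \<iota>_power[of m] assms(5) \<iota>(1) by (simp add: primitive_root_of_unity_def)
  then have z0: "?z \<noteq> 0"
    using \<open>0 < m\<close> by (metis power_0_left not_gr0 zero_neq_one)
  have "0 < p"
    using \<open>prime p\<close> by (rule prime_gt_0_nat)
  have const_power: "const a ^ n = const (a ^ n)" for a :: 'l and n
    by (induction n) (simp_all add: const_mult)
  have hom1: "homogeneous n (x1 ^ n :: 'l poly poly)" for n
    using homogeneous_x1_power_mult[OF homogeneous_1, of n] by simp
  have hom2: "homogeneous n (x2 ^ n :: 'l poly poly)" for n
    using homogeneous_x2_power_mult[OF homogeneous_1, of n] by simp
  \<comment> \<open>Differentiating the power produces the factor p n, which is 0 here; n = 1 and n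
    = m are the cases used below.\<close>
  have partial_p: "partial i (f ^ (p * n)) = 0" for i n and f :: "'l poly poly"
    by (simp add: partial_power p0)
  have "x1 ^ p * x2 ^ p \<in> J_max m ?z c"
  proof (rule invariant_in_J_max[OF z0])
    show "homogeneous (p + p) (x1 ^ p * x2 ^ p :: 'l poly poly)"
      by (intro homogeneous_x1_power_mult hom2)
    show "0 < p + p" using \<open>0 < p\<close> by simp
    show "act (refl_mat ?z k) (x1 ^ p * x2 ^ p) = x1 ^ p * x2 ^ p" for k
    proof -
      \<comment> \<open>A reflection swaps the variables up to mutually inverse scalars, so x1 x2 is
        invariant, and the element in question is its p-th power.\<close>
      have "const (?z ^ k) * const (inverse (?z ^ k)) = 1"
        using z0 by (simp flip: const_mult)
      then have "(const (?z ^ k) * x2) * (const (inverse (?z ^ k)) * x1) = x1 * x2"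
        by (metis mult.commute mult.left_commute mult_1)
      then show ?thesis
        unfolding act_mult act_power act_refl_x1 act_refl_x2 power_mult_distrib[symmetric]
        by (rule arg_cong)
    qed
    show "partial i (x1 ^ p * x2 ^ p :: 'l poly poly) = 0" for i
      using partial_p[of i _ 1] by (simp add: partial_mult)
  qed
  moreover have "x1 ^ (p * m) + x2 ^ (p * m) \<in> J_max m ?z c"
  proof (rule invariant_in_J_max[OF z0])
    show "homogeneous (p * m) (x1 ^ (p * m) + x2 ^ (p * m) :: 'l poly poly)"
      by (intro homogeneous_add hom1 hom2)
    show "0 < p * m" using \<open>0 < p\<close> \<open>0 < m\<close> by simp
    show "act (refl_mat ?z k) (x1 ^ (p * m) + x2 ^ (p * m)) = x1 ^ (p * m) + x2 ^ (p * m)" for k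
    proof -
      \<comment> \<open>The exponent is a multiple of m, so the scalars become 1 and the reflection
        merely exchanges the two summands.\<close>
      have "(?z ^ k) ^ (p * m) = (?z ^ m) ^ (k * p)"
        by (simp add: mult_ac flip: power_mult)
      then have "(?z ^ k) ^ (p * m) = 1"
        by (simp add: zm)
      then show ?thesis
        by (simp add: act_add act_power act_refl_x1 act_refl_x2 power_mult_distrib const_power
            power_inverse)
    qed
    show "partial i (x1 ^ (p * m) + x2 ^ (p * m) :: 'l poly poly) = 0" for i
      by (simp add: partial_add partial_p)
  qed
  ultimately show ?thesis ..
qed

end
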